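(* Let $k\ge 4$ be an even integer and let $\mathrm{CHICHI}_{2k}\colon\mathbb{F}_2^{2k}\to\mathbb{F}_2^{2k}$, $x=(x_0,\dots,x_{2k-1})\mapsto y=(y_0,\dots,y_{2k-1})$, be defined by $$y_i=\begin{cases} x_i+\bar{x}_{i+1}x_{i+2}, & i<k-3 \text{ or } k<i<2k-2,\\ x_k+\bar{x}_{k-2}x_0, & i=k-3,\\ x_{k-1}+\bar{x}_0x_1, & i=k-2,\\ \bar{x}_{k-3}+\bar{x}_k\bar{x}_{k+1}, & i=k-1,\\ x_{k-2}+\bar{x}_{k+1}x_{k+2}, & i=k,\\ x_{2k-2}+\bar{x}_{2k-1}x_{k-1}, & i=2k-2,\\ x_{2k-1}+\bar{x}_{k-1}x_k, & i=2k-1,\end{cases}$$ where $\bar{x}_j=x_j+1$. Then every non-trivial component of the inverse of $\mathrm{CHICHI}_{2k}$ has algebraic degree $k$.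
   Context: $\mathrm{CHICHI}_{2k}$ is a permutation of $\mathbb{F}_2^{2k}$. A non-trivial component of a map $G\colon\mathbb{F}_2^{2k}\to\mathbb{F}_2^{2k}$ is a Boolean function $x\mapsto b\cdot G(x)$ with $b\in\mathbb{F}_2^{2k}\setminus\{0\}$, where $\cdot$ is the standard inner product; the algebraic degree of a Boolean function is the degree of its algebraic normal form. *)

theory Defs
  imports Main
begin

text \<open>Vectors of F_2^n are represented as functions nat => bool (True = 1) that
  vanish outside the index range {0..<n}; addition in F_2 is (\<noteq>), multiplication
  is (\<and>), and the complement x + 1 is negation.\<close>

definition vecs :: "nat \<Rightarrow> (nat \<Rightarrow> bool) set" where
  "vecs n = {x. \<forall>i\<ge>n. \<not> x i}"

definition dotp :: "nat \<Rightarrow> (nat \<Rightarrow> bool) \<Rightarrow> (nat \<Rightarrow> bool) \<Rightarrow> bool" where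
  "dotp n b y = odd (card {i. i < n \<and> b i \<and> y i})"

text \<open>ANF coefficient of the monomial prod_{i in S} x_i of a Boolean function f on F_2^n
  (Moebius transform): sum over all T subset S of f(indicator of T), mod 2.\<close>
definition anf_coeff :: "((nat \<Rightarrow> bool) \<Rightarrow> bool) \<Rightarrow> nat set \<Rightarrow> bool" where
  "anf_coeff f S = odd (card {T. T \<subseteq> S \<and> f (\<lambda>i. i \<in> T)})"

definition alg_degree :: "nat \<Rightarrow> ((nat \<Rightarrow> bool) \<Rightarrow> bool) \<Rightarrow> nat" where
  "alg_degree n f = Max (insert 0 {card S | S. S \<subseteq> {..<n} \<and> anf_coeff f S})"

definition chichi :: "nat \<Rightarrow> (nat \<Rightarrow> bool) \<Rightarrow> (nat \<Rightarrow> bool)" where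
  "chichi k x = (\<lambda>i.
     if i < k - 3 \<or> (k < i \<and> i < 2*k - 2) then x i \<noteq> (\<not> x (i+1) \<and> x (i+2))
     else if i = k - 3 then x k \<noteq> (\<not> x (k-2) \<and> x 0)
     else if i = k - 2 then x (k-1) \<noteq> (\<not> x 0 \<and> x 1)
     else if i = k - 1 then (\<not> x (k-3)) \<noteq> (\<not> x k \<and> \<not> x (k+1))
     else if i = k then x (k-2) \<noteq> (\<not> x (k+1) \<and> x (k+2))
     else if i = 2*k - 2 then x (2*k-2) \<noteq> (\<not> x (2*k-1) \<and> x (k-1))
     else if i = 2*k - 1 then x (2*k-1) \<noteq> (\<not> x (k-1) \<and> x k)
     else False)"

end

theory Submission
  imports Defs "HOL-Library.Z2"
begin

text \<open>
  The coefficient of the monomial with variable set \<open>S\<close> in \<open>b \<cdot> F\<^sup>-\<^sup>1\<close> is the sum over all \<open>x\<close> of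
  \<open>(b \<cdot> x) \<Prod>\<^bsub>i \<notin> S\<^esub> (1 + F\<^sub>i(x))\<close>, that is, the coefficient of the full monomial \<open>x\<^sub>0 \<cdots> x\<^sub>2\<^sub>k\<^sub>-\<^sub>1\<close> in this
  product. All \<open>F\<^sub>i\<close> are quadratic, so it vanishes as soon as \<open>1 + 2 (2k - |S|) < 2k\<close>; this is the upper
  bound \<open>k\<close>. For \<open>|S| = k\<close> at most one factor can contribute less than its quadratic monomial. The
  quadratic monomials are the edges of two odd cycles, of lengths \<open>k - 1\<close> and \<open>k + 1\<close>. Taking for the
  complement of \<open>S\<close> a maximum matching of both cycles together with one further row leaves very few
  contributions, and \<open>2k\<close> such choices give coefficient vectors that span \<open>F\<^sub>2\<^sup>2\<^sup>k\<close>.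
\<close>

section \<open>Boolean polynomials of bounded degree\<close>

text \<open>These rules would turn the field operations of \<^typ>\<open>bit\<close> into Boolean ones and sums into
  cardinalities.\<close>

declare add_bit_eq_xor [simp del] and mult_bit_eq_and [simp del] and sum_of_bool_eq [simp del]

text \<open>Points of the cube are given by their supports \<open>T\<close>, so a monomial is the
  test \<open>U \<subseteq> T\<close>. Adding one monomial at a time, repetitions allowed, makes
  each closure property an induction over monomials.\<close>

inductive degree_le :: "nat \<Rightarrow> ('a set \<Rightarrow> bit) \<Rightarrow> bool" for d where
  degree_le_zero: "degree_le d (\<lambda>T. 0)"
| degree_le_add_monomial:
    "degree_le d f \<Longrightarrow> finite U \<Longrightarrow> card U \<le> d \<Longrightarrow> degree_le d (\<lambda>T. f T + of_bool (U \<subseteq> T))"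

lemma degree_le_monomial: "finite U \<Longrightarrow> card U \<le> d \<Longrightarrow> degree_le d (\<lambda>T. of_bool (U \<subseteq> T))"
  using degree_le_add_monomial[OF degree_le_zero] by fastforce

lemma degree_le_one: "degree_le d (\<lambda>T. 1)"
  using degree_le_monomial[of "{}" d] by simp

lemma degree_le_var: "degree_le 1 (\<lambda>T. of_bool (j \<in> T))"
  using degree_le_monomial[of "{j}" 1] by simp

lemma degree_le_mono: "degree_le d f \<Longrightarrow> d \<le> e \<Longrightarrow> degree_le e f"
  by (induction rule: degree_le.induct) (auto intro: degree_le.intros)

lemma degree_le_add: "degree_le d f \<Longrightarrow> degree_le d g \<Longrightarrow> degree_le d (\<lambda>T. f T + g T)"
proof (induction rule: degree_le.induct)
  case degree_le_zero
  then show ?case by simp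
next
  case (degree_le_add_monomial f U)
  then have "degree_le d (\<lambda>T. (f T + g T) + of_bool (U \<subseteq> T))"
    by (intro degree_le.intros(2)) auto
  then show ?case by (simp add: ac_simps)
qed

text \<open>Variables are idempotent, so the product of the monomials on \<open>V\<close> and
  \<open>U\<close> is the monomial on \<open>V \<union> U\<close>.\<close>

lemma degree_le_monomial_mult:
  assumes "degree_le d f" "finite U" "card U \<le> e"
  shows "degree_le (d + e) (\<lambda>T. f T * of_bool (U \<subseteq> T))"
  using assms
proof (induction rule: degree_le.induct)
  case degree_le_zero
  then show ?case by (simp add: degree_le.intros)
next
  case (degree_le_add_monomial f V)
  have "card (V \<union> U) \<le> d + e"
    using card_Un_le[of V U] degree_le_add_monomial by simp
  then have "degree_le (d + e) (\<lambda>T. f T * of_bool (U \<subseteq> T) + of_bool (V \<union> U \<subseteq> T))"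
    using degree_le_add_monomial by (intro degree_le.intros(2)) auto
  then show ?case by (simp add: distrib_right of_bool_conj[symmetric])
qed

lemma degree_le_mult: "degree_le e g \<Longrightarrow> degree_le d f \<Longrightarrow> degree_le (d + e) (\<lambda>T. f T * g T)"
proof (induction rule: degree_le.induct)
  case degree_le_zero
  then show ?case by (simp add: degree_le.intros)
next
  case (degree_le_add_monomial g U)
  then show ?case
    by (auto simp: distrib_left intro!: degree_le_add degree_le_monomial_mult)
qed

lemma degree_le_sum:
  "(\<And>i. i \<in> I \<Longrightarrow> degree_le d (f i)) \<Longrightarrow> degree_le d (\<lambda>T. \<Sum>i\<in>I. f i T)"
  by (induction I rule: infinite_finite_induct) (auto intro: degree_le_zero degree_le_add)

lemma degree_le_prod:
  "(\<And>i. i \<in> I \<Longrightarrow> degree_le d (f i)) \<Longrightarrow> degree_le (d * card I) (\<lambda>T. \<Prod>i\<in>I. f i T)"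
proof (induction I rule: infinite_finite_induct)
  case (insert i I)
  then have "degree_le (d + d * card I) (\<lambda>T. f i T * (\<Prod>i\<in>I. f i T))"
    by (intro degree_le_mult) auto
  with insert show ?case by simp
qed (auto intro: degree_le_one)

section \<open>Sums over the whole cube\<close>

text \<open>For \<open>U \<subseteq> N\<close> there are \<open>2 ^ card (N - U)\<close> sets
  between \<open>U\<close> and \<open>N\<close>, an odd number only if \<open>U = N\<close>. Summing
  over the cube thus reads off the coefficient of the full monomial.\<close>

lemma cube_sum_monomial:
  assumes "finite N"
  shows "(\<Sum>T\<in>Pow N. of_bool (U \<subseteq> T)) = (of_bool (U = N) :: bit)"
proof (cases "U \<subseteq> N")
  case True
  have "(\<Sum>T\<in>Pow N. of_bool (U \<subseteq> T)) = (\<Sum>T\<in>{T. U \<subseteq> T \<and> T \<subseteq> N}. 1 :: bit)"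
    using assms by (intro sum.mono_neutral_cong_right) auto
  also have "\<dots> = (\<Sum>T\<in>Pow (N - U). 1)"
    by (rule sum.reindex_bij_witness[where i = "\<lambda>T. T \<union> U" and j = "\<lambda>T. T - U"])
       (use True in auto)
  also have "\<dots> = 2 ^ card (N - U)"
    using assms by (simp add: card_Pow)
  also have "\<dots> = of_bool (U = N)"
    using True assms by (auto simp: power_0_left)
  finally show ?thesis .
next
  case False
  then have "(\<Sum>T\<in>Pow N. of_bool (U \<subseteq> T)) = (0 :: bit)"
    by (intro sum.neutral ballI) (auto simp: subset_iff)
  with False show ?thesis by auto
qed

lemma cube_sum_degree_le:
  assumes "degree_le d f" "finite N" "d < card N"
  shows "(\<Sum>T\<in>Pow N. f T) = 0"
  using assms
proof (induction rule: degree_le.induct)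
  case (degree_le_add_monomial f U)
  then have "U \<noteq> N" by auto
  with degree_le_add_monomial show ?case
    by (simp add: sum.distrib cube_sum_monomial)
qed simp

lemma prod_monomials:
  "finite I \<Longrightarrow> (\<Prod>i\<in>I. of_bool (Q i \<subseteq> T)) = (of_bool (\<Union> (Q ` I) \<subseteq> T) :: bit)"
  by (induction I rule: finite_induct) auto

text \<open>Expand the product: \<open>R\<close> collects the terms with at least two factors
  \<open>l i\<close>, which lowers their degree by at least two.\<close>

lemma prod_monomial_plus_linear:
  fixes Q :: "'i \<Rightarrow> 'a set" and l :: "'i \<Rightarrow> 'a set \<Rightarrow> bit"
  assumes "finite I" "I \<noteq> {}"
    and "\<And>i. i \<in> I \<Longrightarrow> finite (Q i) \<and> card (Q i) \<le> 2"
    and "\<And>i. i \<in> I \<Longrightarrow> degree_le 1 (l i)"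
  shows "\<exists>R. degree_le (2 * card I - 2) R \<and>
    (\<forall>T. (\<Prod>i\<in>I. of_bool (Q i \<subseteq> T) + l i T) =
       (\<Prod>i\<in>I. of_bool (Q i \<subseteq> T)) +
       (\<Sum>i\<in>I. l i T * (\<Prod>i'\<in>I - {i}. of_bool (Q i' \<subseteq> T))) + R T)"
  using assms
proof (induction I rule: finite_ne_induct)
  case (singleton i)
  then show ?case by (intro exI[of _ "\<lambda>T. 0"]) (auto intro: degree_le_zero)
next
  case (insert m I)
  define q where "q i T = (of_bool (Q i \<subseteq> T) :: bit)" for i T
  define A where "A T = (\<Prod>i\<in>I. q i T)" for T
  define B where "B T = (\<Sum>i\<in>I. l i T * (\<Prod>i'\<in>I - {i}. q i' T))" for T
  obtain R where R: "degree_le (2 * card I - 2) R"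
    and exp: "\<And>T. (\<Prod>i\<in>I. q i T + l i T) = A T + B T + R T"
    using insert unfolding A_def B_def q_def by auto
  have c: "card I \<ge> 1" using insert.hyps by (simp add: Suc_le_eq card_gt_0_iff)
  have q: "degree_le 2 (q i)" if "i \<in> insert m I" for i
    unfolding q_def using insert.prems that by (intro degree_le_monomial) auto
  have l: "degree_le 1 (l i)" if "i \<in> insert m I" for i
    using insert.prems that by auto
  have B: "degree_le (2 * card I - 1) B"
    unfolding B_def
  proof (rule degree_le_sum)
    fix i assume i: "i \<in> I"
    have "degree_le (1 + 2 * card (I - {i})) (\<lambda>T. l i T * (\<Prod>i'\<in>I - {i}. q i' T))"
      using i l q by (intro degree_le_mult degree_le_prod) auto
    moreover have "1 + 2 * card (I - {i}) = 2 * card I - 1"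
      using i c insert.hyps by (simp add: card_Diff_singleton)
    ultimately show "degree_le (2 * card I - 1) (\<lambda>T. l i T * (\<Prod>i'\<in>I - {i}. q i' T))" by simp
  qed
  \<comment> \<open>These are the new terms with two or more linear factors;
    \<open>2 * card I\<close> equals \<open>2 * card (insert m I) - 2\<close>.\<close>
  have "degree_le (2 * card I) (\<lambda>T. l m T * B T + q m T * R T + l m T * R T)"
  proof (intro degree_le_add)
    show "degree_le (2 * card I) (\<lambda>T. l m T * B T)"
      using degree_le_mult[OF B l[of m]] c by (auto elim: degree_le_mono)
    show "degree_le (2 * card I) (\<lambda>T. q m T * R T)"
      using degree_le_mult[OF R q[of m]] c by (auto elim: degree_le_mono)
    show "degree_le (2 * card I) (\<lambda>T. l m T * R T)"
      using degree_le_mult[OF R l[of m]] c by (auto elim: degree_le_mono)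
  qed
  moreover have "(\<Prod>i\<in>insert m I. q i T + l i T) =
       (\<Prod>i\<in>insert m I. q i T) +
       (\<Sum>i\<in>insert m I. l i T * (\<Prod>i'\<in>insert m I - {i}. q i' T)) +
       (l m T * B T + q m T * R T + l m T * R T)" for T
  proof -
    have "(\<Prod>i\<in>insert m I. q i T + l i T) = (q m T + l m T) * (A T + B T + R T)"
      using insert.hyps by (simp add: exp)
    moreover have "(\<Sum>i\<in>insert m I. l i T * (\<Prod>i'\<in>insert m I - {i}. q i' T)) =
        l m T * A T + q m T * B T"
    proof -
      have "(\<Prod>i'\<in>insert m I - {i}. q i' T) = q m T * (\<Prod>i'\<in>I - {i}. q i' T)" if "i \<in> I" for i
      proof -
        have "insert m I - {i} = insert m (I - {i})" using that insert.hyps by auto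
        then show ?thesis using insert.hyps by simp
      qed
      then have "(\<Sum>i\<in>I. l i T * (\<Prod>i'\<in>insert m I - {i}. q i' T)) = q m T * B T"
        unfolding B_def sum_distrib_left by (intro sum.cong) (auto simp: ac_simps)
      moreover have "insert m I - {m} = I" using insert.hyps by auto
      ultimately show ?thesis using insert.hyps by (simp add: A_def)
    qed
    moreover have "(\<Prod>i\<in>insert m I. q i T) = q m T * A T"
      using insert.hyps by (simp add: A_def)
    ultimately show ?thesis by (simp add: algebra_simps)
  qed
  ultimately show ?case
    using insert.hyps unfolding q_def by (intro exI conjI allI) auto
qed

text \<open>Only monomials on all \<open>2 * card I\<close> variables survive. After multiplication
  by \<open>x_j\<close> the remainder has degree at most \<open>2 * card I - 1\<close>, so what is
  left is the product of all quadratic monomials and the terms in which exactly one row contributes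
  a linear variable \<open>u\<close>.\<close>

lemma cube_sum_var_prod:
  fixes Q L :: "'i \<Rightarrow> 'a set"
  assumes N: "finite N" "card N = 2 * card I" and I: "finite I" "I \<noteq> {}"
    and Q: "\<And>i. i \<in> I \<Longrightarrow> finite (Q i) \<and> card (Q i) \<le> 2"
  shows "(\<Sum>T\<in>Pow N. of_bool (j \<in> T) *
        (\<Prod>i\<in>I. of_bool (Q i \<subseteq> T) + (1 + (\<Sum>u\<in>L i. of_bool (u \<in> T))))) =
      (of_bool (insert j (\<Union> (Q ` I)) = N) +
       (\<Sum>i\<in>I. \<Sum>u\<in>L i. of_bool ({j, u} \<union> \<Union> (Q ` (I - {i})) = N)) :: bit)"
proof -
  define l where "l i T = (1 + (\<Sum>u\<in>L i. of_bool (u \<in> T)) :: bit)" for i T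
  have l1: "degree_le 1 (l i)" if "i \<in> I" for i
    unfolding l_def by (intro degree_le_add degree_le_one degree_le_sum degree_le_var)
  from prod_monomial_plus_linear[of I Q l, OF I Q l1]
  obtain R where R: "degree_le (2 * card I - 2) R"
    and exp: "\<And>T. (\<Prod>i\<in>I. of_bool (Q i \<subseteq> T) + l i T) =
       (\<Prod>i\<in>I. of_bool (Q i \<subseteq> T)) +
       (\<Sum>i\<in>I. l i T * (\<Prod>i'\<in>I - {i}. of_bool (Q i' \<subseteq> T))) + R T"
    by auto
  have c: "card I \<ge> 1" using I by (simp add: Suc_le_eq card_gt_0_iff)
  have "degree_le (1 + (2 * card I - 2)) (\<lambda>T. of_bool (j \<in> T) * R T)"
    using R by (intro degree_le_mult degree_le_var)
  then have R0: "(\<Sum>T\<in>Pow N. of_bool (j \<in> T) * R T) = 0"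
    by (rule cube_sum_degree_le) (use N c in auto)
  have q: "(\<Sum>T\<in>Pow N. of_bool (j \<in> T) * (\<Prod>i\<in>I. of_bool (Q i \<subseteq> T))) =
      (of_bool (insert j (\<Union> (Q ` I)) = N) :: bit)"
    using cube_sum_monomial[OF N(1), of "insert j (\<Union> (Q ` I))"]
    by (simp add: prod_monomials I of_bool_conj[symmetric])
  have l: "(\<Sum>T\<in>Pow N. of_bool (j \<in> T) * (l i T * (\<Prod>i'\<in>I - {i}. of_bool (Q i' \<subseteq> T)))) =
      (\<Sum>u\<in>L i. of_bool ({j, u} \<union> \<Union> (Q ` (I - {i})) = N))" if i: "i \<in> I" for i
  proof -
    let ?U = "\<Union> (Q ` (I - {i}))"
    \<comment> \<open>The remaining pairs and \<open>j\<close> involve at most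
      \<open>2 * card I - 1\<close> variables, so the constant 1 of \<open>l i\<close> contributes
      nothing.\<close>
    have "card ?U \<le> (\<Sum>i'\<in>I - {i}. card (Q i'))"
      using I by (intro card_UN_le) auto
    also have "\<dots> \<le> (\<Sum>i'\<in>I - {i}. 2)"
      using Q by (intro sum_mono) auto
    also have "\<dots> = 2 * card I - 2" using i I by (simp add: card_Diff_singleton)
    finally have "card (insert j ?U) \<le> 2 * card I - 1"
      using c I Q by (auto simp: card_insert_if)
    then have "insert j ?U \<noteq> N" using N c by auto
    then have "(\<Sum>T\<in>Pow N. of_bool (insert j ?U \<subseteq> T)) = (0 :: bit)"
      by (simp only: cube_sum_monomial[OF N(1)]) simp
    moreover have "of_bool (j \<in> T) * (l i T * (\<Prod>i'\<in>I - {i}. of_bool (Q i' \<subseteq> T))) =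
        of_bool (insert j ?U \<subseteq> T) + (\<Sum>u\<in>L i. of_bool ({j, u} \<union> ?U \<subseteq> T))" for T
      unfolding l_def using I
      by (simp add: prod_monomials distrib_left distrib_right sum_distrib_left sum_distrib_right
          of_bool_conj[symmetric] conj_ac)
    ultimately show ?thesis
      by (simp only: sum.distrib sum.swap[of _ "L i"] cube_sum_monomial[OF N(1)]) simp
  qed
  have "(\<Sum>T\<in>Pow N. of_bool (j \<in> T) * (\<Prod>i\<in>I. of_bool (Q i \<subseteq> T) + l i T)) =
      (\<Sum>T\<in>Pow N. of_bool (j \<in> T) * (\<Prod>i\<in>I. of_bool (Q i \<subseteq> T))) +
      (\<Sum>i\<in>I. \<Sum>T\<in>Pow N. of_bool (j \<in> T) * (l i T * (\<Prod>i'\<in>I - {i}. of_bool (Q i' \<subseteq> T)))) +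
      (\<Sum>T\<in>Pow N. of_bool (j \<in> T) * R T)"
    unfolding exp distrib_left sum.distrib sum_distrib_left sum.swap[of _ I] ..
  also have "\<dots> = of_bool (insert j (\<Union> (Q ` I)) = N) +
       (\<Sum>i\<in>I. \<Sum>u\<in>L i. of_bool ({j, u} \<union> \<Union> (Q ` (I - {i})) = N))"
    unfolding q R0 using l by (simp del: Un_insert_left)
  finally show ?thesis unfolding l_def .
qed

section \<open>The map is a permutation\<close>

lemma finite_vecs: "finite (vecs n)"
proof -
  have "vecs n \<subseteq> (\<lambda>T i. i \<in> T) ` Pow {..<n}"
  proof
    fix x assume "x \<in> vecs n"
    then have "x = (\<lambda>i. i \<in> {i. x i})" "{i. x i} \<subseteq> {..<n}"
      by (auto simp: vecs_def not_less[symmetric])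
    then show "x \<in> (\<lambda>T i. i \<in> T) ` Pow {..<n}" by blast
  qed
  then show ?thesis by (rule finite_subset) auto
qed

text \<open>Multiplying \<open>y\<^sub>1 = x\<^sub>1 + (x\<^sub>2 + 1) x\<^sub>3\<close> by \<open>x\<^sub>2\<close> gives \<open>x\<^sub>1 x\<^sub>2 = y\<^sub>1 x\<^sub>2\<close>, so that
  \<open>x\<^sub>0 = y\<^sub>0 + (y\<^sub>1 + 1) x\<^sub>2\<close> is affine in \<open>x\<^sub>2\<close>.\<close>

lemma chi_difference_step:
  assumes "y0 = (x0 \<noteq> (\<not> x1 \<and> x2))" "y0 = (z0 \<noteq> (\<not> z1 \<and> z2))"
    and "y1 = (x1 \<noteq> (\<not> x2 \<and> x3))" "y1 = (z1 \<noteq> (\<not> z2 \<and> z3))"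
    and "x0 \<noteq> z0"
  shows "x2 \<noteq> z2 \<and> \<not> y1"
  using assms by blast

lemma difference_chain:
  fixes i t :: nat
  assumes "\<And>s. s < t \<Longrightarrow> D (i + 2 * s) \<Longrightarrow> D (i + 2 * s + 2) \<and> \<not> y (i + 2 * s + 1)" "D i"
  shows "D (i + 2 * t) \<and> (\<forall>s<t. \<not> y (i + 2 * s + 1))"
  using assms
proof (induction t)
  case (Suc t)
  then have "D (i + 2 * t) \<and> (\<forall>s<t. \<not> y (i + 2 * s + 1))" by simp
  with Suc.prems(1)[of t] show ?case by (auto simp: less_Suc_eq)
qed simp

text \<open>Where \<open>y\<close> vanishes, the row forces \<open>x\<close> to be zero whenever
  \<open>x\<close> is zero two places further on; a zero at the end travels back to
  \<open>i\<close>.\<close>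

lemma zero_chain:
  fixes i t :: nat
  assumes "\<And>s. s < t \<Longrightarrow> y (i + 2 * s) = (x (i + 2 * s) \<noteq> (\<not> x (i + 2 * s + 1) \<and> x (i + 2 * s + 2)))"
    and "\<And>s. s < t \<Longrightarrow> \<not> y (i + 2 * s)" and "\<not> x (i + 2 * t)"
  shows "\<not> x i"
  using assms
proof (induction t)
  case (Suc t)
  then show ?case using Suc.prems(1)[of t] by auto
qed simp

text \<open>Writing \<open>k\<close> as \<open>2 * g + 4\<close> makes all special row indices
  linear in \<open>g\<close>, free of truncated subtraction.\<close>

lemma chichi_rows:
  fixes g :: nat and x :: "nat \<Rightarrow> bool"
  defines "y \<equiv> chichi (2 * g + 4) x"
  shows "i < 2 * g + 1 \<or> (2 * g + 4 < i \<and> i < 4 * g + 6) \<Longrightarrow> y i = (x i \<noteq> (\<not> x (i+1) \<and> x (i+2)))"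
    and "y (2 * g + 1) = (x (2 * g + 4) \<noteq> (\<not> x (2 * g + 2) \<and> x 0))"
    and "y (2 * g + 2) = (x (2 * g + 3) \<noteq> (\<not> x 0 \<and> x 1))"
    and "y (2 * g + 3) = (\<not> x (2 * g + 1) \<noteq> (\<not> x (2 * g + 4) \<and> \<not> x (2 * g + 5)))"
    and "y (2 * g + 4) = (x (2 * g + 2) \<noteq> (\<not> x (2 * g + 5) \<and> x (2 * g + 6)))"
    and "y (4 * g + 6) = (x (4 * g + 6) \<noteq> (\<not> x (4 * g + 7) \<and> x (2 * g + 3)))"
    and "y (4 * g + 7) = (x (4 * g + 7) \<noteq> (\<not> x (2 * g + 3) \<and> x (2 * g + 4)))"
  unfolding y_def chichi_def by (auto simp: algebra_simps)

text \<open>A difference step at \<open>i\<close> needs only this shape of row \<open>i + 1\<close>.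
  Leaving \<open>c\<close> open includes row \<open>4 * g + 6\<close>, whose product wraps around to
  \<open>x (2 * g + 3)\<close>.\<close>

lemma chichi_next_row:
  assumes "i < 2 * g \<or> (2 * g + 4 < i \<and> i < 4 * g + 6)"
  shows "\<exists>c. chichi (2 * g + 4) x (i + 1) = (x (i + 1) \<noteq> (\<not> x (i + 2) \<and> c))"
proof (cases "i = 4 * g + 5")
  case True
  then have "i + 1 = 4 * g + 6" "i + 2 = 4 * g + 7" by auto
  then show ?thesis using chichi_rows(6)[of g x] by metis
next
  case False
  with assms have "i + 1 < 2 * g + 1 \<or> (2 * g + 4 < i + 1 \<and> i + 1 < 4 * g + 6)" by auto
  from chichi_rows(1)[OF this] show ?thesis by auto
qed

text \<open>Follow the positions \<open>D\<close> where two preimages of \<open>y\<close> differ. A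
  difference at \<open>2 * g + 2\<close> moves on through \<open>2 * g + 6\<close>, ...,
  \<open>4 * g + 6\<close>, \<open>2 * g + 3\<close>, 1, ..., up to \<open>2 * g + 1\<close>.
  Excluding a difference at this last position clears the chain, and the remaining positions
  follow.\<close>

lemma chichi_inj:
  fixes g :: nat
  shows "inj_on (chichi (2 * g + 4)) (vecs (2 * (2 * g + 4)))"
proof (rule inj_onI)
  fix x z
  assume vec: "x \<in> vecs (2 * (2 * g + 4))" "z \<in> vecs (2 * (2 * g + 4))"
    and eq: "chichi (2 * g + 4) x = chichi (2 * g + 4) z"
  define y where "y = chichi (2 * g + 4) x"
  define D where "D i \<longleftrightarrow> x i \<noteq> z i" for i
  note X = chichi_rows[where g = g and x = x, folded y_def]
  note Z = chichi_rows[where g = g and x = z, folded eq, folded y_def]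
  have step: "D (i + 2) \<and> \<not> y (i + 1)"
    if i: "i < 2 * g \<or> (2 * g + 4 < i \<and> i < 4 * g + 6)" "D i" for i
  proof -
    obtain c where "y (i + 1) = (x (i + 1) \<noteq> (\<not> x (i + 2) \<and> c))"
      using chichi_next_row[OF i(1), of x] unfolding y_def by blast
    moreover obtain d where "y (i + 1) = (z (i + 1) \<noteq> (\<not> z (i + 2) \<and> d))"
      using chichi_next_row[OF i(1), of z] unfolding y_def eq by blast
    moreover have "i < 2 * g + 1 \<or> (2 * g + 4 < i \<and> i < 4 * g + 6)" using i by auto
    ultimately show ?thesis
      using chi_difference_step[OF X(1) Z(1)] i(2) unfolding D_def by blast
  qed
  have chain: "D j \<and> (\<forall>s<t. \<not> y (i + 2 * s + 1))"
    if "D i" "j = i + 2 * t" "j < 2 * g + 2 \<or> (2 * g + 4 < i \<and> j < 4 * g + 8)" for i j t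
    unfolding that(2) using that by (intro difference_chain step) auto
  have odd_A: "D (2 * g + 1)" if "D (2 * s + 1)" "s \<le> g" for s
    using that by (intro conjunct1[OF chain[of "2 * s + 1" "2 * g + 1" "g - s"]]) auto
  have even_A: "D (2 * g)" if "D (2 * s)" "s \<le> g" for s
    using that by (intro conjunct1[OF chain[of "2 * s" "2 * g" "g - s"]]) auto
  have even_B: "D (4 * g + 6)" if "D (2 * g + 6 + 2 * s)" "s \<le> g" for s
    using that by (intro conjunct1[OF chain[of "2 * g + 6 + 2 * s" "4 * g + 6" "g - s"]]) auto
  have odd_B: "D (4 * g + 7)" if "D (2 * g + 5 + 2 * s)" "s \<le> g + 1" for s
    using that by (intro conjunct1[OF chain[of "2 * g + 5 + 2 * s" "4 * g + 7" "g + 1 - s"]]) auto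
  have row0: "y 0 = (x 0 \<noteq> (\<not> x 1 \<and> x 2))" "y 0 = (z 0 \<noteq> (\<not> z 1 \<and> z 2))"
    using X(1)[of 0] Z(1)[of 0] unfolding add_0 by simp_all
  have row5: "y (2 * g + 5) = (x (2 * g + 5) \<noteq> (\<not> x (2 * g + 6) \<and> x (2 * g + 7)))"
    "y (2 * g + 5) = (z (2 * g + 5) \<noteq> (\<not> z (2 * g + 6) \<and> z (2 * g + 7)))"
    using X(1)[of "2 * g + 5"] Z(1)[of "2 * g + 5"] by (simp_all add: ac_simps)
  have r: "D 1 \<and> \<not> y 0" if "D (2 * g + 3)"
    using chi_difference_step[OF X(3) Z(3) row0] that unfolding D_def by blast
  have last: "D (2 * g + 3) \<and> \<not> y (4 * g + 7)" if "D (4 * g + 6)"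
    using chi_difference_step[OF X(6) Z(6) X(7) Z(7)] that unfolding D_def by blast
  have w: "D (2 * g + 6) \<and> \<not> y (2 * g + 5)" if "D (2 * g + 2)"
    using chi_difference_step[OF X(5) Z(5) row5] that unfolding D_def by blast
  have first: "D (2 * g + 1)" if "D 1"
    using odd_A[of 0] that by simp
  have "\<not> D (2 * g + 1)"
  proof
    assume u: "D (2 * g + 1)"
    have pq: "(\<not> x (2 * g + 4) \<and> \<not> x (2 * g + 5)) \<noteq> (\<not> z (2 * g + 4) \<and> \<not> z (2 * g + 5))"
      using u X(4) Z(4) unfolding D_def by blast
    have q_same: False if "\<not> D (2 * g + 4)" "\<not> D (4 * g + 7)"
      using pq odd_B[of 0] that by (auto simp: D_def)
    \<comment> \<open>By \<open>pq\<close>, a common value at \<open>2 * g + 4\<close> must be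
      false, which kills the product in row \<open>4 * g + 7\<close>.\<close>
    have D_last_odd: "\<not> D (4 * g + 7)" if "\<not> D (2 * g + 4)"
      using that pq X(7) Z(7) by (auto simp: D_def)
    have q: "D (2 * g + 4)" using q_same D_last_odd by blast
    show False
    proof (cases "D (2 * g + 2)")
      case False
      have "\<not> D (2 * g + 4)"
      proof (cases "x (2 * g + 2)")
        case True
        then show ?thesis using X(2) Z(2) False by (auto simp: D_def)
      next
        case w0: False
        then have "\<not> D (2 * g)"
          using X(1)[of "2 * g"] Z(1)[of "2 * g"] False by (auto simp: D_def)
        then show ?thesis using even_A[of 0] X(2) Z(2) False by (auto simp: D_def)
      qed
      with q show False by simp
    next
      case True
      \<comment> \<open>The chain from \<open>2 * g + 2\<close> passes through 1 and the odd
        positions up to \<open>2 * g + 1\<close>; each of these moves forces the even-indexed value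
        of \<open>y\<close> in between to vanish.\<close>
      have yA: "\<not> y (2 * s)" if "s \<le> g" for s
      proof (cases s)
        case 0
        then show ?thesis using True w even_B[of 0] last r by auto
      next
        case (Suc s')
        have "D 1" using True w even_B[of 0] last r by auto
        with chain[of 1 "2 * g + 1" g] have "\<forall>s<g. \<not> y (1 + 2 * s + 1)" by simp
        then show ?thesis using Suc that by auto
      qed
      \<comment> \<open>The product in row \<open>2 * g + 1\<close> therefore vanishes for both
        preimages: if \<open>v (2 * g + 2)\<close> is false, the zeros of \<open>y\<close> make
        \<open>v (2 * g)\<close> and then \<open>v 0\<close> false.\<close>
      have "\<not> (\<not> v (2 * g + 2) \<and> v 0)"
        if "\<And>i. i < 2 * g + 1 \<Longrightarrow> y i = (v i \<noteq> (\<not> v (i + 1) \<and> v (i + 2)))" for v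
      proof -
        have "\<not> v (2 * g)" if "\<not> v (2 * g + 2)"
          using that \<open>\<And>i. i < 2 * g + 1 \<Longrightarrow> _ i\<close>[of "2 * g"] yA[of g] by auto
        then show ?thesis using zero_chain[of g y 0 v] that yA by auto
      qed
      from this[of x] this[of z] have "\<not> D (2 * g + 4)"
        using X(1,2) Z(1,2) by (auto simp: D_def)
      with q show False by simp
    qed
  qed
  then have "\<not> D (2 * g + 1)" "\<not> D (2 * g + 3)" "\<not> D (4 * g + 6)" "\<not> D (2 * g + 2)"
    using first r last w even_B[of 0] by auto
  moreover from this have "\<not> D (2 * g)"
    using X(1)[of "2 * g"] Z(1)[of "2 * g"] by (auto simp: D_def)
  moreover from calculation have "\<not> D (2 * g + 4)"
    using even_A[of 0] X(2) Z(2) by (auto simp: D_def)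
  moreover from calculation have "\<not> D (4 * g + 7)"
    using X(7) Z(7) by (auto simp: D_def)
  ultimately have "\<not> D i" if "i < 4 * g + 8" for i
  proof -
    have "(\<exists>s\<le>g. i = 2 * s + 1) \<or> (\<exists>s\<le>g. i = 2 * s) \<or>
        i = 2 * g + 2 \<or> i = 2 * g + 3 \<or> i = 2 * g + 4 \<or>
        (\<exists>s\<le>g+1. i = 2 * g + 5 + 2 * s) \<or> (\<exists>s\<le>g. i = 2 * g + 6 + 2 * s)"
      using that by presburger
    then show ?thesis
      by (elim disjE exE conjE) (use \<open>\<not> D (2 * g + 1)\<close> \<open>\<not> D (2 * g + 3)\<close> \<open>\<not> D (4 * g + 6)\<close> \<open>\<not> D (2 * g + 2)\<close>
        \<open>\<not> D (2 * g)\<close> \<open>\<not> D (2 * g + 4)\<close> \<open>\<not> D (4 * g + 7)\<close> odd_A even_A even_B odd_B in auto)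
  qed
  moreover have "\<not> D i" if "i \<ge> 4 * g + 8" for i
    using vec that by (auto simp: vecs_def D_def)
  ultimately have "\<not> D i" for i
    by (meson not_less)
  then show "x = z" by (auto simp: D_def)
qed

lemma chichi_beyond:
  assumes "i \<ge> 4 * g + 8"
  shows "\<not> chichi (2 * g + 4) x i"
proof -
  have "\<not> (i < 2 * g + 4 - 3 \<or> (2 * g + 4 < i \<and> i < 2 * (2 * g + 4) - 2))"
    "i \<noteq> 2 * g + 4 - 3" "i \<noteq> 2 * g + 4 - 2" "i \<noteq> 2 * g + 4 - 1" "i \<noteq> 2 * g + 4"
    "i \<noteq> 2 * (2 * g + 4) - 2" "i \<noteq> 2 * (2 * g + 4) - 1"
    using assms by auto
  then show ?thesis unfolding chichi_def by (simp only: if_False if_True simp_thms)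
qed

lemma chichi_bij: "bij_betw (chichi (2 * g + 4)) (vecs (4 * g + 8)) (vecs (4 * g + 8))"
proof -
  have "chichi (2 * g + 4) ` vecs (4 * g + 8) \<subseteq> vecs (4 * g + 8)"
    by (auto simp: vecs_def chichi_beyond)
  moreover have "inj_on (chichi (2 * g + 4)) (vecs (4 * g + 8))"
    using chichi_inj[of g] by (simp add: algebra_simps)
  ultimately show ?thesis
    using finite_vecs endo_inj_surj unfolding bij_betw_def by blast
qed

section \<open>Coefficients of the inverse\<close>

lemma of_bool_odd: "of_bool (odd n) = (of_nat n :: bit)" for n :: nat
  by (induction n) auto

text \<open>Substituting \<open>x = F(y)\<close> turns the Moebius sum of a component of the inverse into a sum over
  \<open>x\<close> in which the restriction to the subcube becomes the product of the \<open>1 + F\<^sub>i(x)\<close>.\<close>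

lemma anf_coeff_inverse:
  assumes F: "bij_betw F (vecs n) (vecs n)" and S: "S \<subseteq> {..<n}"
  shows "of_bool (anf_coeff (\<lambda>x. dotp n b (inv_into (vecs n) F x)) S) =
    (\<Sum>j | j < n \<and> b j. \<Sum>T\<in>Pow {..<n}. of_bool (j \<in> T) *
       (\<Prod>i\<in>{..<n} - S. of_bool (\<not> F (\<lambda>i. i \<in> T) i)) :: bit)"
proof -
  let ?G = "inv_into (vecs n) F"
  let ?I = "\<lambda>T i. i \<in> T"
  have vec: "?I T \<in> vecs n \<longleftrightarrow> T \<subseteq> {..<n}" for T :: "nat set"
    unfolding vecs_def subset_iff mem_Collect_eq lessThan_iff by (meson linorder_not_le)
  have sub: "{i. x i} \<subseteq> {..<n}" if "x \<in> vecs n" for x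
    using that unfolding vecs_def subset_iff mem_Collect_eq lessThan_iff by (meson linorder_not_le)
  have FG: "F (?G x) = x" "?G x \<in> vecs n" if "x \<in> vecs n" for x
    using F that by (auto simp: bij_betw_def f_inv_into_f intro: inv_into_into)
  have GF: "?G (F x) = x" "F x \<in> vecs n" if "x \<in> vecs n" for x
    using F that by (auto simp: bij_betw_def)
  let ?X = "{T. T \<subseteq> S \<and> dotp n b (?G (?I T))}"
  let ?Y = "{T. T \<subseteq> {..<n} \<and> (\<forall>i\<in>{..<n} - S. \<not> F (?I T) i) \<and> dotp n b (?I T)}"
  \<comment> \<open>The inverse map, read on supports, carries subsets of \<open>S\<close> to the
    points whose image under \<open>F\<close> vanishes outside \<open>S\<close>.\<close>
  have "bij_betw (\<lambda>T. {i. ?G (?I T) i}) ?X ?Y"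
  proof (rule bij_betw_byWitness[where f' = "\<lambda>T. {i. F (?I T) i}"])
    show "\<forall>T\<in>?X. {i. F (?I {i. ?G (?I T) i}) i} = T"
      using S vec FG(1) by (auto dest: order_trans)
    show "\<forall>T\<in>?Y. {i. ?G (?I {i. F (?I T) i}) i} = T"
      using vec GF(1) by auto
    show "(\<lambda>T. {i. ?G (?I T) i}) ` ?X \<subseteq> ?Y"
    proof (intro image_subsetI CollectI conjI)
      fix T assume T: "T \<in> ?X"
      then have v: "?I T \<in> vecs n" using S vec by (auto dest: order_trans)
      show "{i. ?G (?I T) i} \<subseteq> {..<n}" using sub FG(2)[OF v] by blast
      show "\<forall>i\<in>{..<n} - S. \<not> F (?I {i. ?G (?I T) i}) i" using T FG(1)[OF v] by auto
      show "dotp n b (?I {i. ?G (?I T) i})" using T by simp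
    qed
    show "(\<lambda>T. {i. F (?I T) i}) ` ?Y \<subseteq> ?X"
    proof (intro image_subsetI CollectI conjI)
      fix T assume T: "T \<in> ?Y"
      then have v: "?I T \<in> vecs n" using vec by auto
      show "{i. F (?I T) i} \<subseteq> S" using T sub[OF GF(2)[OF v]] by auto
      show "dotp n b (?G (?I {i. F (?I T) i}))" using T GF(1)[OF v] by simp
    qed
  qed
  then have "card ?X = card ?Y" by (rule bij_betw_same_card)
  then have "of_bool (anf_coeff (\<lambda>x. dotp n b (?G x)) S) = (of_nat (card ?Y) :: bit)"
    unfolding anf_coeff_def of_bool_odd by simp
  also have "\<dots> = (\<Sum>T\<in>?Y. 1)" by simp
  also have "\<dots> = (\<Sum>T\<in>Pow {..<n}. of_bool (dotp n b (?I T)) *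
      of_bool (\<forall>i\<in>{..<n} - S. \<not> F (?I T) i))"
    by (rule sum.mono_neutral_cong_left) auto
  also have "\<dots> = (\<Sum>T\<in>Pow {..<n}. \<Sum>j | j < n \<and> b j. of_bool (j \<in> T) *
       (\<Prod>i\<in>{..<n} - S. of_bool (\<not> F (?I T) i)))"
  proof (rule sum.cong)
    fix T
    have "(of_nat (card {j. j < n \<and> b j \<and> j \<in> T}) :: bit) = (\<Sum>j | j < n \<and> b j \<and> j \<in> T. 1)"
      by simp
    also have "\<dots> = (\<Sum>j | j < n \<and> b j. of_bool (j \<in> T))"
      by (rule sum.mono_neutral_cong_left) auto
    finally have "of_bool (dotp n b (?I T)) = (\<Sum>j | j < n \<and> b j. of_bool (j \<in> T) :: bit)"
      unfolding dotp_def of_bool_odd .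
    moreover have "of_bool (\<forall>i\<in>A. P i) = (\<Prod>i\<in>A. of_bool (P i) :: bit)" if "finite A" for A :: "nat set" and P
      using that by (induction A rule: finite_induct) auto
    ultimately show "of_bool (dotp n b (?I T)) * of_bool (\<forall>i\<in>{..<n} - S. \<not> F (?I T) i) =
        (\<Sum>j | j < n \<and> b j. of_bool (j \<in> T) * (\<Prod>i\<in>{..<n} - S. of_bool (\<not> F (?I T) i)) :: bit)"
      by (simp add: sum_distrib_right)
  qed simp
  finally show ?thesis by (subst sum.swap)
qed

text \<open>With \<open>k = 2 g + 4\<close> the complement of row \<open>i\<close> of \<open>chichi k\<close> has the algebraic normal form
  \<open>1 + (\<Sum>u\<in>lin g i. x\<^sub>u) + (\<Prod>u\<in>quad g i. x\<^sub>u)\<close>. The pairs \<open>quad g i\<close> are the edges of two disjoint odd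
  cycles, on \<open>{0..k-2}\<close> and on \<open>{k-1..2k-1}\<close>.\<close>

definition quad :: "nat \<Rightarrow> nat \<Rightarrow> nat set" where
  "quad g i =
    (if i = 2 * g + 1 then {2 * g + 2, 0}
     else if i = 2 * g + 2 then {0, 1}
     else if i = 4 * g + 6 then {4 * g + 7, 2 * g + 3}
     else if i = 4 * g + 7 then {2 * g + 3, 2 * g + 4}
     else {i + 1, i + 2})"

definition lin :: "nat \<Rightarrow> nat \<Rightarrow> nat set" where
  "lin g i =
    (if i = 2 * g + 1 then {2 * g + 4, 0}
     else if i = 2 * g + 2 then {2 * g + 3, 1}
     else if i = 2 * g + 3 then {2 * g + 1, 2 * g + 4, 2 * g + 5}
     else if i = 2 * g + 4 then {2 * g + 2, 2 * g + 6}
     else if i = 4 * g + 6 then {4 * g + 6, 2 * g + 3}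
     else if i = 4 * g + 7 then {4 * g + 7, 2 * g + 4}
     else {i, i + 2})"

lemma chichi_row_anf:
  assumes "i < 4 * g + 8"
  shows "of_bool (\<not> chichi (2 * g + 4) (\<lambda>i. i \<in> T) i) =
    (of_bool (quad g i \<subseteq> T) + (1 + (\<Sum>u\<in>lin g i. of_bool (u \<in> T))) :: bit)"
proof -
  consider "i < 2 * g + 1 \<or> (2 * g + 4 < i \<and> i < 4 * g + 6)" | "i = 2 * g + 1" | "i = 2 * g + 2"
    | "i = 2 * g + 3" | "i = 2 * g + 4" | "i = 4 * g + 6" | "i = 4 * g + 7"
    using assms by linarith
  then show ?thesis
  proof cases
    case 1
    then have "quad g i = {i + 1, i + 2}" "lin g i = {i, i + 2}"
      by (auto simp: quad_def lin_def)
    with chichi_rows(1)[OF 1] show ?thesis by auto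
  next
    case 2
    with chichi_rows(2)[of g "\<lambda>i. i \<in> T"] show ?thesis by (auto simp: quad_def lin_def)
  next
    case 3
    with chichi_rows(3)[of g "\<lambda>i. i \<in> T"] show ?thesis by (auto simp: quad_def lin_def)
  next
    case 4
    then have "quad g i = {2 * g + 4, 2 * g + 5}" by (simp add: quad_def ac_simps)
    with 4 chichi_rows(4)[of g "\<lambda>i. i \<in> T"] show ?thesis by (auto simp: lin_def)
  next
    case 5
    then have "quad g i = {2 * g + 5, 2 * g + 6}" by (simp add: quad_def ac_simps)
    with 5 chichi_rows(5)[of g "\<lambda>i. i \<in> T"] show ?thesis by (auto simp: lin_def)
  next
    case 6
    with chichi_rows(6)[of g "\<lambda>i. i \<in> T"] show ?thesis by (auto simp: quad_def lin_def)
  next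
    case 7
    with chichi_rows(7)[of g "\<lambda>i. i \<in> T"] show ?thesis by (auto simp: quad_def lin_def)
  qed
qed

lemma quad_bounds: "finite (quad g i) \<and> card (quad g i) \<le> 2"
  by (auto simp: quad_def card_insert_if)

lemma quad_subset: "i < 4 * g + 8 \<Longrightarrow> quad g i \<subseteq> {..<4 * g + 8}"
  by (auto simp: quad_def)

lemma lin_subset: "i < 4 * g + 8 \<Longrightarrow> lin g i \<subseteq> {..<4 * g + 8}"
  by (auto simp: lin_def)

text \<open>The coefficient in the \<open>j\<close>-th coordinate of the inverse of the monomial whose variables are
  the indices outside \<open>I\<close>.\<close>

definition coef :: "nat \<Rightarrow> nat set \<Rightarrow> nat \<Rightarrow> bit" where
  "coef g I j = (\<Sum>T\<in>Pow {..<4 * g + 8}. of_bool (j \<in> T) *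
     (\<Prod>i\<in>I. of_bool (\<not> chichi (2 * g + 4) (\<lambda>i. i \<in> T) i)))"

section \<open>Coefficients as covering conditions\<close>

lemma coef_alt:
  assumes "I \<subseteq> {..<4 * g + 8}"
  shows "coef g I j = (\<Sum>T\<in>Pow {..<4 * g + 8}. of_bool (j \<in> T) *
     (\<Prod>i\<in>I. of_bool (quad g i \<subseteq> T) + (1 + (\<Sum>u\<in>lin g i. of_bool (u \<in> T)))))"
  unfolding coef_def using assms
  by (intro sum.cong arg_cong2[where f = "(*)"] prod.cong refl chichi_row_anf) auto

text \<open>The summand has degree at most \<open>1 + 2 * card I\<close>, hence at most
  \<open>4 * g + 7\<close>, one short of the number of variables. This gives the upper bound on the
  degree.\<close>

lemma coef_eq_0:
  assumes "I \<subseteq> {..<4 * g + 8}" "card I < 2 * g + 4"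
  shows "coef g I j = 0"
proof -
  have "degree_le (1 + 2 * card I) (\<lambda>T. of_bool (j \<in> T) *
     (\<Prod>i\<in>I. of_bool (quad g i \<subseteq> T) + (1 + (\<Sum>u\<in>lin g i. of_bool (u \<in> T)))))"
    using quad_bounds
    by (intro degree_le_mult degree_le_var degree_le_prod degree_le_add degree_le_monomial
        degree_le_one degree_le_sum degree_le_mono[OF degree_le_var]) auto
  then show ?thesis
    unfolding coef_alt[OF assms(1)] by (rule cube_sum_degree_le) (use assms in auto)
qed

text \<open>Sets of at most two elements whose union reaches \<open>2 * card M\<close> leave no room
  for an overlap.\<close>

lemma matching_disjoint:
  assumes M: "finite M" and Q: "\<And>i. i \<in> M \<Longrightarrow> finite (Q i) \<and> card (Q i) \<le> 2"
    and card: "2 * card M \<le> card (\<Union> (Q ` M))" and i: "i \<in> M"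
  shows "Q i \<inter> \<Union> (Q ` (M - {i})) = {}"
proof -
  let ?U = "\<Union> (Q ` (M - {i}))"
  have fin: "finite ?U" "finite (Q i)" using M Q i by auto
  have "card ?U \<le> (\<Sum>i'\<in>M - {i}. card (Q i'))"
    using M by (intro card_UN_le) auto
  also have "\<dots> \<le> (\<Sum>i'\<in>M - {i}. 2)"
    using Q by (intro sum_mono) auto
  also have "\<dots> = 2 * card M - 2" using M i by (simp add: card_Diff_singleton)
  finally have U: "card ?U \<le> 2 * card M - 2" .
  have "Q ` M = insert (Q i) (Q ` (M - {i}))" using i by auto
  then have "card (\<Union> (Q ` M)) = card (Q i \<union> ?U)" by simp
  moreover have "card (Q i \<union> ?U) + card (Q i \<inter> ?U) = card (Q i) + card ?U"
    using card_Un_Int[OF fin(2,1)] by simp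
  moreover have "card M \<ge> 1" using M i by (auto simp: Suc_le_eq card_gt_0_iff)
  ultimately have "card (Q i \<inter> ?U) = 0"
    using U Q[OF i] card by linarith
  then show ?thesis using fin by simp
qed

text \<open>The edges of \<open>M\<close> cover everything except the holes \<open>a\<close> and
  \<open>b\<close>. The three terms say how the holes get filled: by \<open>j\<close> and the edge
  of \<open>m\<close>; by \<open>j\<close> and a linear variable of \<open>m\<close>; or, if a row
  \<open>i\<close> of \<open>M\<close> contributes a linear variable, by \<open>j\<close>,
  \<open>u\<close> and the edge of \<open>m\<close>, which must then also replace the edge of
  \<open>i\<close>.\<close>

lemma coef_matching:
  assumes M: "M \<subseteq> {..<4 * g + 8}" "card M \<le> 2 * g + 3"
      "\<Union> (quad g ` M) = {..<4 * g + 8} - {a, b}"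
    and ab: "a < 4 * g + 8" "b < 4 * g + 8" "a \<noteq> b"
    and m: "m < 4 * g + 8" "m \<notin> M" and j: "j < 4 * g + 8"
  shows "card (insert m M) = 2 * g + 4"
    and "coef g (insert m M) j = of_bool ({a, b} \<subseteq> insert j (quad g m)) +
      (\<Sum>u\<in>lin g m. of_bool ({a, b} \<subseteq> {j, u})) +
      (\<Sum>i\<in>M. \<Sum>u\<in>lin g i. of_bool ({a, b} \<union> quad g i \<subseteq> {j, u} \<union> quad g m))"
proof -
  have fin: "finite M" using M(1) finite_subset by blast
  have "card (\<Union> (quad g ` M)) = 4 * g + 6"
    unfolding M(3) using ab by (subst card_Diff_subset) auto
  moreover have "card (\<Union> (quad g ` M)) \<le> (\<Sum>i\<in>M. card (quad g i))"
    using fin by (rule card_UN_le)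
  moreover have "\<dots> \<le> (\<Sum>i\<in>M. 2)" using quad_bounds by (intro sum_mono) auto
  \<comment> \<open>Covering \<open>4 * g + 6\<close> vertices by pairs takes at least
    \<open>2 * g + 3\<close> rows, so the assumed bound is attained.\<close>
  ultimately have cM: "card M = 2 * g + 3" "2 * card M \<le> card (\<Union> (quad g ` M))"
    using M(2) by auto
  then show card: "card (insert m M) = 2 * g + 4" using fin m by simp
  have ins: "insert m M \<subseteq> {..<4 * g + 8}" using M m by auto
  have disj: "quad g i \<inter> \<Union> (quad g ` (M - {i})) = {}" if "i \<in> M" for i
    using matching_disjoint[OF fin quad_bounds cM(2) that] .
  have first: "insert j (\<Union> (quad g ` insert m M)) = {..<4 * g + 8} \<longleftrightarrow>
      {a, b} \<subseteq> insert j (quad g m)"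
    using M(3) quad_subset[OF m(1)] j ab by auto
  have second: "{j, u} \<union> \<Union> (quad g ` (insert m M - {m})) = {..<4 * g + 8} \<longleftrightarrow> {a, b} \<subseteq> {j, u}"
    if "u \<in> lin g m" for u
  proof -
    have "insert m M - {m} = M" "u < 4 * g + 8" using m lin_subset[of m g] that by auto
    then show ?thesis using M(3) j ab by auto
  qed
  have third: "{j, u} \<union> \<Union> (quad g ` (insert m M - {i})) = {..<4 * g + 8} \<longleftrightarrow>
      {a, b} \<union> quad g i \<subseteq> {j, u} \<union> quad g m" if i: "i \<in> M" and u: "u \<in> lin g i" for i u
  proof -
    have u': "u < 4 * g + 8" "quad g i \<subseteq> {..<4 * g + 8}"
      using lin_subset[of i g] quad_subset[of i g] i u M(1) by auto
    have eq: "insert m M - {i} = insert m (M - {i})" using i m by auto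
    have un: "\<Union> (quad g ` M) = quad g i \<union> \<Union> (quad g ` (M - {i}))" using i by auto
    have "\<Union> (quad g ` (M - {i})) = {..<4 * g + 8} - ({a, b} \<union> quad g i)"
      using disj[OF i] M(3) unfolding un by blast
    then show ?thesis
      unfolding eq using u' quad_subset[OF m(1)] j ab by auto
  qed
  have "coef g (insert m M) j = of_bool (insert j (\<Union> (quad g ` insert m M)) = {..<4 * g + 8}) +
      (\<Sum>i\<in>insert m M. \<Sum>u\<in>lin g i.
        of_bool ({j, u} \<union> \<Union> (quad g ` (insert m M - {i})) = {..<4 * g + 8}))"
    unfolding coef_alt[OF ins]
    by (rule cube_sum_var_prod) (use card fin quad_bounds in auto)
  also have "\<dots> = of_bool ({a, b} \<subseteq> insert j (quad g m)) +
      ((\<Sum>u\<in>lin g m. of_bool ({a, b} \<subseteq> {j, u})) +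
      (\<Sum>i\<in>M. \<Sum>u\<in>lin g i. of_bool ({a, b} \<union> quad g i \<subseteq> {j, u} \<union> quad g m)))"
    unfolding first sum.insert[OF fin m(2)] using second third
    by (intro arg_cong2[where f = "(+)"] sum.cong refl arg_cong[where f = of_bool])
  finally show "coef g (insert m M) j = of_bool ({a, b} \<subseteq> insert j (quad g m)) +
      (\<Sum>u\<in>lin g m. of_bool ({a, b} \<subseteq> {j, u})) +
      (\<Sum>i\<in>M. \<Sum>u\<in>lin g i. of_bool ({a, b} \<union> quad g i \<subseteq> {j, u} \<union> quad g m))"
    by (simp only: add.assoc)
qed

section \<open>Matchings of the two cycles\<close>

lemma mod_wrap: "m mod n = (if m < n then m else m - n)" if "m < 2 * n" for m n :: nat
  using that by (simp add: le_mod_geq)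

text \<open>Starting at \<open>a\<close> and taking every second edge covers the offsets 1, ...,
  \<open>2 * h\<close> from \<open>a\<close>, in consecutive pairs.\<close>

lemma odd_cycle_matching:
  fixes a h n :: nat
  assumes n: "n = 2 * h + 1" and a: "a < n"
  shows "(\<Union>r\<in>(\<lambda>t. (a + 2 * t) mod n) ` {..<h}. {(r + 1) mod n, (r + 2) mod n}) = {..<n} - {a}"
proof -
  have "(\<Union>r\<in>(\<lambda>t. (a + 2 * t) mod n) ` {..<h}. {(r + 1) mod n, (r + 2) mod n}) =
      (\<Union>t<h. {(a + (2 * t + 1)) mod n, (a + (2 * t + 2)) mod n})"
    by (simp add: mod_simps add.assoc)
  also have "\<dots> = {..<n} - {a}"
  proof (intro equalityI subsetI)
    fix v assume "v \<in> (\<Union>t<h. {(a + (2 * t + 1)) mod n, (a + (2 * t + 2)) mod n})"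
    then obtain t where "t < h" "v = (a + (2 * t + 1)) mod n \<or> v = (a + (2 * t + 2)) mod n"
      by blast
    moreover from this have "2 * t + 1 < n" "2 * t + 2 < n" using n by auto
    ultimately obtain s where s: "v = (a + s) mod n" "0 < s" "s < n"
      by (metis add_gr_0 zero_less_numeral zero_less_one)
    then show "v \<in> {..<n} - {a}" using a by (auto simp: mod_if)
  next
    fix v assume v: "v \<in> {..<n} - {a}"
    \<comment> \<open>\<open>s\<close> is the offset of \<open>v\<close> from \<open>a\<close>
      around the cycle.\<close>
    define s where "s = (if a < v then v - a else v + n - a)"
    have s: "v = (a + s) mod n" "0 < s" "s < n"
      using v a by (auto simp: s_def)
    define t where "t = (s - 1) div 2"
    have "t < h" "s = 2 * t + 1 \<or> s = 2 * t + 2"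
      using s n unfolding t_def by presburger+
    then show "v \<in> (\<Union>t<h. {(a + (2 * t + 1)) mod n, (a + (2 * t + 2)) mod n})"
      using s(1) by auto
  qed
  finally show ?thesis .
qed

text \<open>The rows whose edges match all vertices except \<open>a\<close> in the first cycle and \<open>2 g + 3 + c\<close> in the
  second one.\<close>

definition matching :: "nat \<Rightarrow> nat \<Rightarrow> nat \<Rightarrow> nat set" where
  "matching g a c = (\<lambda>t. (a + 2 * t) mod (2 * g + 3)) ` {..<g + 1} \<union>
     (\<lambda>t. 2 * g + 3 + (c + 2 * t) mod (2 * g + 5)) ` {..<g + 2}"

text \<open>After shifting the second cycle by \<open>2 * g + 3\<close>, the edge of row
  \<open>r\<close> is \<open>{r + 1, r + 2}\<close> modulo the length in both cycles, so the
  odd-cycle matching applies to each.\<close>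

lemma matching_properties:
  assumes "a < 2 * g + 3" "c < 2 * g + 5"
  shows "matching g a c \<subseteq> {..<4 * g + 8}" "card (matching g a c) \<le> 2 * g + 3"
    "\<Union> (quad g ` matching g a c) = {..<4 * g + 8} - {a, 2 * g + 3 + c}"
proof -
  define A where "A = (\<lambda>t. (a + 2 * t) mod (2 * g + 3)) ` {..<g + 1}"
  define B where "B = (\<lambda>t. (c + 2 * t) mod (2 * g + 5)) ` {..<g + 2}"
  have M: "matching g a c = A \<union> (+) (2 * g + 3) ` B"
    by (simp add: matching_def A_def B_def image_image)
  have A: "A \<subseteq> {..<2 * g + 3}" and B: "B \<subseteq> {..<2 * g + 5}"
    by (auto simp: A_def B_def)
  show "matching g a c \<subseteq> {..<4 * g + 8}" unfolding M using A B by auto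
  have "card A \<le> g + 1"
    unfolding A_def using card_image_le[of "{..<g + 1}" "\<lambda>t. (a + 2 * t) mod (2 * g + 3)"] by simp
  moreover have "card ((+) (2 * g + 3) ` B) \<le> g + 2"
    unfolding B_def image_image
    using card_image_le[of "{..<g + 2}" "\<lambda>t. 2 * g + 3 + (c + 2 * t) mod (2 * g + 5)"] by simp
  ultimately show "card (matching g a c) \<le> 2 * g + 3"
    unfolding M using card_Un_le[of A "(+) (2 * g + 3) ` B"] by linarith
  have qA: "quad g r = {(r + 1) mod (2 * g + 3), (r + 2) mod (2 * g + 3)}" if "r \<in> A" for r
  proof -
    have "r < 2 * g + 3" using A that by auto
    then show ?thesis
      by (subst (1 2) mod_wrap) (auto simp: quad_def)
  qed
  have qB: "quad g (2 * g + 3 + r) = (+) (2 * g + 3) ` {(r + 1) mod (2 * g + 5), (r + 2) mod (2 * g + 5)}"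
    if "r \<in> B" for r
  proof -
    have "r < 2 * g + 5" using B that by auto
    then show ?thesis
      by (subst (1 2) mod_wrap) (auto simp: quad_def)
  qed
  have "\<Union> (quad g ` matching g a c) = (\<Union>r\<in>A. quad g r) \<union> (\<Union>r\<in>B. quad g (2 * g + 3 + r))"
    unfolding M by (simp add: image_Un image_image)
  also have "(\<Union>r\<in>A. quad g r) = {..<2 * g + 3} - {a}"
    using odd_cycle_matching[of "2 * g + 3" "g + 1" a] assms(1) qA unfolding A_def[symmetric] by simp
  also have "(\<Union>r\<in>B. quad g (2 * g + 3 + r)) =
      (+) (2 * g + 3) ` (\<Union>r\<in>B. {(r + 1) mod (2 * g + 5), (r + 2) mod (2 * g + 5)})"
    unfolding image_UN using qB by (intro SUP_cong refl)
  also have "\<dots> = (+) (2 * g + 3) ` ({..<2 * g + 5} - {c})"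
    using odd_cycle_matching[of "2 * g + 5" "g + 2" c] assms(2) unfolding B_def[symmetric] by simp
  also have "\<dots> = {2 * g + 3..<4 * g + 8} - {2 * g + 3 + c}"
  proof (intro equalityI subsetI)
    fix v assume "v \<in> {2 * g + 3..<4 * g + 8} - {2 * g + 3 + c}"
    then have "v = 2 * g + 3 + (v - (2 * g + 3))" "v - (2 * g + 3) \<in> {..<2 * g + 5} - {c}" by auto
    then show "v \<in> (+) (2 * g + 3) ` ({..<2 * g + 5} - {c})" by blast
  qed auto
  also have "{..<2 * g + 3} - {a} \<union> ({2 * g + 3..<4 * g + 8} - {2 * g + 3 + c}) =
      {..<4 * g + 8} - {a, 2 * g + 3 + c}"
  proof (rule set_eqI)
    fix v
    show "v \<in> {..<2 * g + 3} - {a} \<union> ({2 * g + 3..<4 * g + 8} - {2 * g + 3 + c}) \<longleftrightarrow>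
        v \<in> {..<4 * g + 8} - {a, 2 * g + 3 + c}"
      using assms by (cases "v < 2 * g + 3") simp_all
  qed
  finally show "\<Union> (quad g ` matching g a c) = {..<4 * g + 8} - {a, 2 * g + 3 + c}" .
qed

section \<open>Coefficient vectors of a matching with one further row\<close>

text \<open>Each vertex lies on two edges only; in the third sum this pins down the row
  \<open>i\<close> that could be replaced by \<open>m\<close>.\<close>

lemma quad_memD:
  assumes "v \<in> quad g i" "i < 4 * g + 8"
  shows "v = 0 \<Longrightarrow> i = 2 * g + 1 \<or> i = 2 * g + 2"
    and "v = 2 * g + 4 \<Longrightarrow> i = 2 * g + 3 \<or> i = 4 * g + 7"
    and "v = 2 * g + 5 \<Longrightarrow> i = 2 * g + 3 \<or> i = 2 * g + 4"
    and "v = 2 * g + 6 \<Longrightarrow> i = 2 * g + 4 \<or> i = 2 * g + 5"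
  using assms by (auto simp: quad_def split: if_splits)

lemma card_quad: "card (quad g i) = 2"
  by (auto simp: quad_def)

lemma matching_quad:
  assumes "a < 2 * g + 3" "c < 2 * g + 5" "b = 2 * g + 3 + c" "i \<in> matching g a c"
  shows "i < 4 * g + 8" "quad g i \<inter> {a, b} = {}"
  using matching_properties[OF assms(1,2)] assms(3,4) by auto

lemma matching_starts:
  "a < 2 * g + 3 \<Longrightarrow> a \<in> matching g a c" "c < 2 * g + 5 \<Longrightarrow> b = 2 * g + 3 + c \<Longrightarrow> b \<in> matching g a c"
  unfolding matching_def by (auto intro!: image_eqI[where x = 0])

lemma not_in_matching_A:
  assumes "r < 2 * g + 3" "\<And>t. t < g + 1 \<Longrightarrow> (a + 2 * t) mod (2 * g + 3) \<noteq> r"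
  shows "r \<notin> matching g a c"
  using assms by (force simp: matching_def)

lemma not_in_matching_B:
  assumes "i = 2 * g + 3 + r" "\<And>t. t < g + 2 \<Longrightarrow> (c + 2 * t) mod (2 * g + 5) \<noteq> r"
  shows "i \<notin> matching g a c"
proof
  assume "i \<in> matching g a c"
  then consider t where "i = (a + 2 * t) mod (2 * g + 3)"
    | t where "t < g + 2" "i = 2 * g + 3 + (c + 2 * t) mod (2 * g + 5)"
    unfolding matching_def by blast
  then show False
  proof cases
    case 1
    then have "i < 2 * g + 3" by simp
    with assms(1) show False by simp
  qed (use assms in auto)
qed

lemma finite_matching: "finite (matching g a c)"
  by (simp add: matching_def)

text \<open>In the third sum the left side has exactly four elements and the right side at most
  four, so inclusion becomes equality. This lets vertices on the right exclude rows \<open>i\<close>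
  as well.\<close>

lemma coef_insert_matching:
  assumes a: "a < 2 * g + 3" and c: "c < 2 * g + 5" and b: "b = 2 * g + 3 + c"
    and m: "m < 4 * g + 8" "m \<notin> matching g a c"
  shows "card (insert m (matching g a c)) = 2 * g + 4"
    and "j < 4 * g + 8 \<Longrightarrow> coef g (insert m (matching g a c)) j =
      of_bool ({a, b} \<subseteq> insert j (quad g m)) +
      (\<Sum>u\<in>lin g m. of_bool ({a, b} \<subseteq> {j, u})) +
      (\<Sum>i\<in>matching g a c. \<Sum>u\<in>lin g i.
        of_bool ({a, b} \<union> quad g i = {j, u} \<union> quad g m))"
proof -
  have "b < 4 * g + 8" "a < 4 * g + 8" "a \<noteq> b" using a b c by auto
  note C = coef_matching[OF matching_properties[OF a c, folded b] this(2,1,3) m]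
  show "card (insert m (matching g a c)) = 2 * g + 4" by (rule C(1)[of 0]) simp
  have tight: "{a, b} \<union> quad g i \<subseteq> {j, u} \<union> quad g m \<longleftrightarrow>
      {a, b} \<union> quad g i = {j, u} \<union> quad g m" if i: "i \<in> matching g a c" for i u
  proof
    assume sub: "{a, b} \<union> quad g i \<subseteq> {j, u} \<union> quad g m"
    have "card ({a, b} \<union> quad g i) = card {a, b} + card (quad g i)"
      using matching_quad(2)[OF a c b i] quad_bounds by (intro card_Un_disjoint) auto
    also have "\<dots> = 4" using a b by (simp add: card_quad)
    finally have 4: "card ({a, b} \<union> quad g i) = 4" .
    have "card ({j, u} \<union> quad g m) \<le> card {j, u} + card (quad g m)" by (rule card_Un_le)
    also have "\<dots> \<le> 4" by (simp add: card_quad card_insert_if)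
    finally show "{a, b} \<union> quad g i = {j, u} \<union> quad g m"
      using sub 4 quad_bounds by (intro card_seteq) auto
  qed simp
  assume j: "j < 4 * g + 8"
  show "coef g (insert m (matching g a c)) j =
      of_bool ({a, b} \<subseteq> insert j (quad g m)) +
      (\<Sum>u\<in>lin g m. of_bool ({a, b} \<subseteq> {j, u})) +
      (\<Sum>i\<in>matching g a c. \<Sum>u\<in>lin g i.
        of_bool ({a, b} \<union> quad g i = {j, u} \<union> quad g m))"
    unfolding C(2)[OF j]
    by (intro arg_cong2[where f = "(+)"] refl sum.cong arg_cong[where f = of_bool] tight)
qed

lemma sum_single:
  assumes "finite A" "x \<in> A" "\<And>i. i \<in> A \<Longrightarrow> i \<noteq> x \<Longrightarrow> f i = 0"
  shows "(\<Sum>i\<in>A. f i) = (f x :: bit)"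
  using assms by (simp add: sum.remove[of A x])

lemma quad_special:
  "quad g (2 * g + 1) = {2 * g + 2, 0}"
  "quad g (2 * g + 2) = {0, 1}"
  "quad g (2 * g + 3) = {2 * g + 4, 2 * g + 5}"
  "quad g (2 * g + 4) = {2 * g + 5, 2 * g + 6}"
  "quad g (4 * g + 7) = {2 * g + 3, 2 * g + 4}"
  by (auto simp: quad_def)

lemma lin_special:
  "lin g (2 * g + 1) = {2 * g + 4, 0}"
  "lin g (2 * g + 2) = {2 * g + 3, 1}"
  "lin g (2 * g + 3) = {2 * g + 1, 2 * g + 4, 2 * g + 5}"
  "lin g (2 * g + 4) = {2 * g + 2, 2 * g + 6}"
  "lin g (4 * g + 7) = {4 * g + 7, 2 * g + 4}"
  by (auto simp: lin_def)

text \<open>The row sets below were read off from the inverses for \<open>k = 4, 6, 8\<close>.\<close>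

lemma coef_A:
  assumes a: "a < 2 * g + 3"
  defines "I \<equiv> insert (2 * g + 3) (matching g a 1)"
  shows "card I = 2 * g + 4"
    and "j < 4 * g + 8 \<Longrightarrow> coef g I j = of_bool (j = a) +
      of_bool (a = 2 * g + 1 \<and> j = 2 * g + 4) + of_bool (a = 2 * g + 2 \<and> j = 2 * g + 6)"
proof -
  have b: "2 * g + 4 = 2 * g + 3 + (1 :: nat)" "1 < 2 * g + 5" by auto
  note q = matching_quad[OF a b(2,1)]
  have mb: "2 * g + 3 < 4 * g + (8 :: nat)" by simp
  have m: "2 * g + 3 \<notin> matching g a 1"
    using q(2)[of "2 * g + 3"] unfolding quad_special by auto
  note i0 = matching_starts(2)[OF b(2,1), of a]
  note C = coef_insert_matching[OF a b(2,1) mb m]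
  show "card I = 2 * g + 4" unfolding I_def by (rule C(1))
  assume j: "j < 4 * g + 8"
  let ?h = "\<lambda>i. \<Sum>u\<in>lin g i. of_bool ({a, 2 * g + 4} \<union> quad g i = {j, u} \<union> quad g (2 * g + 3)) :: bit"
  have h0: "?h i = 0" if i: "i \<in> matching g a 1" "i \<noteq> 2 * g + 4" for i
  proof -
    \<comment> \<open>The right side contains \<open>2 * g + 5\<close>, whose edges belong to the
      rows \<open>2 * g + 3\<close> and \<open>2 * g + 4\<close>; the former is not in the
      matching.\<close>
    have "2 * g + 5 \<notin> quad g i" using quad_memD(3)[of "2 * g + 5" g i] q(1)[of i] i m by auto
    then have "{a, 2 * g + 4} \<union> quad g i \<noteq> {j, u} \<union> quad g (2 * g + 3)" for u
      using a unfolding quad_special by (auto simp: set_eq_subset)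
    then show ?thesis by simp
  qed
  have "(\<Sum>i\<in>matching g a 1. ?h i) = ?h (2 * g + 4)"
    by (rule sum_single[OF finite_matching i0 h0])
  also have "\<dots> = of_bool (j = a) + of_bool (a = 2 * g + 2 \<and> j = 2 * g + 6)"
  proof -
    have "{a, 2 * g + 4} \<union> quad g (2 * g + 4) = {j, 2 * g + 2} \<union> quad g (2 * g + 3) \<longleftrightarrow>
        a = 2 * g + 2 \<and> j = 2 * g + 6"
      "{a, 2 * g + 4} \<union> quad g (2 * g + 4) = {j, 2 * g + 6} \<union> quad g (2 * g + 3) \<longleftrightarrow> j = a"
      using a unfolding quad_special by (auto simp: set_eq_subset)
    then show ?thesis unfolding lin_special by simp
  qed
  finally have third: "(\<Sum>i\<in>matching g a 1. ?h i) =
      of_bool (j = a) + of_bool (a = 2 * g + 2 \<and> j = 2 * g + 6)" .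
  have second: "(\<Sum>u\<in>lin g (2 * g + 3). of_bool ({a, 2 * g + 4} \<subseteq> {j, u})) =
     (of_bool (j = a) + of_bool (a = 2 * g + 1 \<and> j = 2 * g + 4) :: bit)"
    using a unfolding lin_special by auto
  have first: "{a, 2 * g + 4} \<subseteq> insert j (quad g (2 * g + 3)) \<longleftrightarrow> j = a"
    using a unfolding quad_special by auto
  show "coef g I j = of_bool (j = a) +
      of_bool (a = 2 * g + 1 \<and> j = 2 * g + 4) + of_bool (a = 2 * g + 2 \<and> j = 2 * g + 6)"
    \<comment> \<open>Each of the three terms contributes \<open>of_bool (j = a)\<close>; modulo 2
      one copy remains.\<close>
    unfolding I_def C(2)[OF j] first second third by (cases "j = a") auto
qed

text \<open>The linear variable \<open>2 * g + 1\<close> of row \<open>2 * g + 3\<close> fills the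
  hole of the first cycle, so \<open>j\<close> must fill \<open>b\<close>.\<close>

lemma coef_B_odd:
  assumes c: "even c" "2 \<le> c" "c < 2 * g + 5" and b: "b = 2 * g + 3 + c"
  defines "I \<equiv> insert (2 * g + 3) (matching g (2 * g + 1) c)"
  shows "card I = 2 * g + 4" and "j < 4 * g + 8 \<Longrightarrow> coef g I j = of_bool (j = b)"
proof -
  have a: "2 * g + 1 < 2 * g + (3 :: nat)" by simp
  note q = matching_quad[OF a c(3) b]
  have mb: "2 * g + 3 < 4 * g + (8 :: nat)" by simp
  have m: "2 * g + 3 \<notin> matching g (2 * g + 1) c"
  proof (rule not_in_matching_B[where r = 0])
    fix t assume "t < g + 2"
    \<comment> \<open>The even number \<open>c + 2 * t\<close> is positive, below twice the cycle
      length, and differs from that odd length.\<close>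
    then have "c + 2 * t < 2 * (2 * g + 5)" "c + 2 * t \<noteq> 2 * g + 5" using c by presburger+
    with c show "(c + 2 * t) mod (2 * g + 5) \<noteq> 0" by (auto simp: mod_wrap)
  qed simp
  note C = coef_insert_matching[OF a c(3) b mb m]
  show "card I = 2 * g + 4" unfolding I_def by (rule C(1))
  assume j: "j < 4 * g + 8"
  have neq: "{2 * g + 1, b} \<union> quad g i \<noteq> {j, u} \<union> quad g (2 * g + 3)"
    if i: "i \<in> matching g (2 * g + 1) c" and u: "u \<in> lin g i" for i u
  proof
    assume eq: "{2 * g + 1, b} \<union> quad g i = {j, u} \<union> quad g (2 * g + 3)"
    then have "2 * g + 4 \<in> {2 * g + 1, b} \<union> quad g i" unfolding quad_special by auto
    then have "2 * g + 4 \<in> quad g i" using b c by auto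
    then have i7: "i = 4 * g + 7" using quad_memD(2)[of "2 * g + 4" g i] q(1)[of i] i m by auto
    have "2 * g + 1 \<in> {j, u} \<union> {2 * g + 4, 2 * g + 5}" "2 * g + 3 \<in> {j, u} \<union> {2 * g + 4, 2 * g + 5}"
      using eq unfolding i7 quad_special by blast+
    then show False using u unfolding i7 lin_special by auto
  qed
  have third: "(\<Sum>i\<in>matching g (2 * g + 1) c. \<Sum>u\<in>lin g i.
      of_bool ({2 * g + 1, b} \<union> quad g i = {j, u} \<union> quad g (2 * g + 3))) = (0 :: bit)"
    using neq by (intro sum.neutral ballI) simp
  have second: "(\<Sum>u\<in>lin g (2 * g + 3). of_bool ({2 * g + 1, b} \<subseteq> {j, u})) =
     (of_bool (j = b) + of_bool (c = 2 \<and> j = 2 * g + 1) :: bit)"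
    using b c unfolding lin_special by auto
  have first: "{2 * g + 1, b} \<subseteq> insert j (quad g (2 * g + 3)) \<longleftrightarrow> c = 2 \<and> j = 2 * g + 1"
    using b c unfolding quad_special by auto
  show "coef g I j = of_bool (j = b)"
    \<comment> \<open>For \<open>c = 2\<close> the vertex \<open>b\<close> lies on the edge of row
      \<open>2 * g + 3\<close>; the extra term at \<open>j = 2 * g + 1\<close> occurs twice and
      cancels.\<close>
    unfolding I_def C(2)[OF j] first second third by auto
qed

text \<open>Here the variable \<open>2 * g + 2\<close> of row \<open>2 * g + 4\<close> fills the
  hole of the first cycle. Left out are \<open>c = 1\<close>, where this row is already in the
  matching, and \<open>c = 3\<close>, where \<open>b\<close> lies on its edge.\<close>

lemma coef_B_even:
  assumes c: "c = 0 \<or> odd c \<and> 5 \<le> c" "c < 2 * g + 5" and b: "b = 2 * g + 3 + c"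
  defines "I \<equiv> insert (2 * g + 4) (matching g (2 * g + 2) c)"
  shows "card I = 2 * g + 4" and "j < 4 * g + 8 \<Longrightarrow> coef g I j = of_bool (j = b)"
proof -
  have a: "2 * g + 2 < 2 * g + (3 :: nat)" by simp
  note q = matching_quad[OF a c(2) b]
  have mb: "2 * g + 4 < 4 * g + (8 :: nat)" by simp
  have m: "2 * g + 4 \<notin> matching g (2 * g + 2) c"
  proof (rule not_in_matching_B[where r = 1])
    fix t assume "t < g + 2"
    then have "c + 2 * t < 2 * (2 * g + 5)" "c + 2 * t \<noteq> 1" "c + 2 * t \<noteq> 2 * g + 6"
      using c by presburger+
    then show "(c + 2 * t) mod (2 * g + 5) \<noteq> 1" by (subst mod_wrap) auto
  qed simp
  note C = coef_insert_matching[OF a c(2) b mb m]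
  show "card I = 2 * g + 4" unfolding I_def by (rule C(1))
  assume j: "j < 4 * g + 8"
  have neq: "{2 * g + 2, b} \<union> quad g i \<noteq> {j, u} \<union> quad g (2 * g + 4)"
    if i: "i \<in> matching g (2 * g + 2) c" for i u
  proof
    assume "{2 * g + 2, b} \<union> quad g i = {j, u} \<union> quad g (2 * g + 4)"
    then have "{2 * g + 5, 2 * g + 6} \<subseteq> {2 * g + 2, b} \<union> quad g i" unfolding quad_special by auto
    then have "2 * g + 5 \<in> quad g i" "2 * g + 6 \<in> quad g i" using b c by auto
    then have "i = 2 * g + 4"
      using quad_memD(3)[of "2 * g + 5" g i] quad_memD(4)[of "2 * g + 6" g i] q(1)[of i] i by auto
    with i m show False by simp
  qed
  have third: "(\<Sum>i\<in>matching g (2 * g + 2) c. \<Sum>u\<in>lin g i.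
      of_bool ({2 * g + 2, b} \<union> quad g i = {j, u} \<union> quad g (2 * g + 4))) = (0 :: bit)"
    using neq by (intro sum.neutral ballI) simp
  have second: "(\<Sum>u\<in>lin g (2 * g + 4). of_bool ({2 * g + 2, b} \<subseteq> {j, u})) = (of_bool (j = b) :: bit)"
    using b c unfolding lin_special by auto
  have first: "\<not> {2 * g + 2, b} \<subseteq> insert j (quad g (2 * g + 4))"
    using b c unfolding quad_special by auto
  show "coef g I j = of_bool (j = b)"
    unfolding I_def C(2)[OF j] second third using first by auto
qed

text \<open>Now a variable of the second cycle, \<open>2 * g + 3\<close> in row
  \<open>2 * g + 2\<close>, fills the hole \<open>b\<close>, and \<open>j\<close> fills
  \<open>a\<close>.\<close>

lemma coef_A_odd_end:
  fixes g :: nat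
  defines "I \<equiv> insert (2 * g + 2) (matching g (2 * g + 1) 0)"
  shows "card I = 2 * g + 4" and "j < 4 * g + 8 \<Longrightarrow> coef g I j = of_bool (j = 2 * g + 1)"
proof -
  have a: "2 * g + 1 < 2 * g + (3 :: nat)" and b: "2 * g + 3 = 2 * g + 3 + (0 :: nat)" "0 < 2 * g + 5"
    by auto
  note q = matching_quad[OF a b(2,1)]
  have mb: "2 * g + 2 < 4 * g + (8 :: nat)" by simp
  have m: "2 * g + 2 \<notin> matching g (2 * g + 1) 0"
  proof (rule not_in_matching_A)
    fix t assume "t < g + 1"
    then have "2 * g + 1 + 2 * t < 2 * (2 * g + 3)" "2 * g + 1 + 2 * t \<noteq> 2 * g + 2"
      "2 * g + 1 + 2 * t \<noteq> 4 * g + 5" by presburger+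
    then show "(2 * g + 1 + 2 * t) mod (2 * g + 3) \<noteq> 2 * g + 2" by (subst mod_wrap) auto
  qed simp
  note C = coef_insert_matching[OF a b(2,1) mb m]
  show "card I = 2 * g + 4" unfolding I_def by (rule C(1))
  assume j: "j < 4 * g + 8"
  have neq: "{2 * g + 1, 2 * g + 3} \<union> quad g i \<noteq> {j, u} \<union> quad g (2 * g + 2)"
    if i: "i \<in> matching g (2 * g + 1) 0" and u: "u \<in> lin g i" for i u
  proof
    assume eq: "{2 * g + 1, 2 * g + 3} \<union> quad g i = {j, u} \<union> quad g (2 * g + 2)"
    then have "0 \<in> quad g i" unfolding quad_special by (auto simp: set_eq_subset)
    then have i1: "i = 2 * g + 1" using quad_memD(1)[of 0 g i] q(1)[of i] i m by auto
    have "2 * g + 2 \<in> {j, u} \<union> {0, 1}" "2 * g + 3 \<in> {j, u} \<union> {0, 1}"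
      using eq unfolding i1 quad_special by blast+
    then show False using u unfolding i1 lin_special by auto
  qed
  have third: "(\<Sum>i\<in>matching g (2 * g + 1) 0. \<Sum>u\<in>lin g i.
      of_bool ({2 * g + 1, 2 * g + 3} \<union> quad g i = {j, u} \<union> quad g (2 * g + 2))) = (0 :: bit)"
    using neq by (intro sum.neutral ballI) simp
  have second: "(\<Sum>u\<in>lin g (2 * g + 2). of_bool ({2 * g + 1, 2 * g + 3} \<subseteq> {j, u})) =
     (of_bool (j = 2 * g + 1) + of_bool (g = 0 \<and> j = 2 * g + 3) :: bit)"
    unfolding lin_special by auto
  have first: "{2 * g + 1, 2 * g + 3} \<subseteq> insert j (quad g (2 * g + 2)) \<longleftrightarrow> g = 0 \<and> j = 2 * g + 3"
    unfolding quad_special by auto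
  show "coef g I j = of_bool (j = 2 * g + 1)"
    \<comment> \<open>For \<open>g = 0\<close> the vertices 1 and \<open>2 * g + 1\<close> coincide;
      the resulting extra terms at \<open>j = 2 * g + 3\<close> cancel.\<close>
    unfolding I_def C(2)[OF j] first second third by auto
qed

text \<open>The variable \<open>2 * g + 4\<close> of row \<open>2 * g + 1\<close> fills
  \<open>b\<close>. The edge of that row fills \<open>a\<close> instead, giving
  \<open>j = 2 * g + 4\<close>, but this term cancels against the one from replacing row
  \<open>2 * g + 2\<close>.\<close>

lemma coef_A_even_end:
  fixes g :: nat
  defines "I \<equiv> insert (2 * g + 1) (matching g (2 * g + 2) 1)"
  shows "card I = 2 * g + 4" and "j < 4 * g + 8 \<Longrightarrow> coef g I j = of_bool (j = 2 * g + 2)"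
proof -
  have a: "2 * g + 2 < 2 * g + (3 :: nat)" and b: "2 * g + 4 = 2 * g + 3 + (1 :: nat)" "1 < 2 * g + 5"
    by auto
  note q = matching_quad[OF a b(2,1)]
  have mb: "2 * g + 1 < 4 * g + (8 :: nat)" by simp
  have m: "2 * g + 1 \<notin> matching g (2 * g + 2) 1"
    using q(2)[of "2 * g + 1"] unfolding quad_special by auto
  note i0 = matching_starts(1)[OF a, of 1]
  note C = coef_insert_matching[OF a b(2,1) mb m]
  show "card I = 2 * g + 4" unfolding I_def by (rule C(1))
  assume j: "j < 4 * g + 8"
  let ?h = "\<lambda>i. \<Sum>u\<in>lin g i. of_bool ({2 * g + 2, 2 * g + 4} \<union> quad g i = {j, u} \<union> quad g (2 * g + 1)) :: bit"
  have h0: "?h i = 0" if i: "i \<in> matching g (2 * g + 2) 1" "i \<noteq> 2 * g + 2" for i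
  proof -
    have "0 \<notin> quad g i" using quad_memD(1)[of 0 g i] q(1)[of i] i m by auto
    then have "{2 * g + 2, 2 * g + 4} \<union> quad g i \<noteq> {j, u} \<union> quad g (2 * g + 1)" for u
      unfolding quad_special by (auto simp: set_eq_subset)
    then show ?thesis by simp
  qed
  have "(\<Sum>i\<in>matching g (2 * g + 2) 1. ?h i) = ?h (2 * g + 2)"
    by (rule sum_single[OF finite_matching i0 h0])
  also have "\<dots> = of_bool (j = 2 * g + 4)"
  proof -
    have "{2 * g + 2, 2 * g + 4} \<union> quad g (2 * g + 2) \<noteq> {j, 2 * g + 3} \<union> quad g (2 * g + 1)"
      "{2 * g + 2, 2 * g + 4} \<union> quad g (2 * g + 2) = {j, 1} \<union> quad g (2 * g + 1) \<longleftrightarrow> j = 2 * g + 4"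
      unfolding quad_special by (auto simp: set_eq_subset)
    then show ?thesis unfolding lin_special by simp
  qed
  finally have third: "(\<Sum>i\<in>matching g (2 * g + 2) 1. ?h i) = of_bool (j = 2 * g + 4)" .
  have second: "(\<Sum>u\<in>lin g (2 * g + 1). of_bool ({2 * g + 2, 2 * g + 4} \<subseteq> {j, u})) =
     (of_bool (j = 2 * g + 2) :: bit)"
    unfolding lin_special by auto
  have first: "{2 * g + 2, 2 * g + 4} \<subseteq> insert j (quad g (2 * g + 1)) \<longleftrightarrow> j = 2 * g + 4"
    unfolding quad_special by auto
  show "coef g I j = of_bool (j = 2 * g + 2)"
    unfolding I_def C(2)[OF j] first second third by auto
qed

section \<open>Spanning and the degree of every component\<close>

text \<open>If the sum over \<open>B\<close> vanished on all the coefficient vectors computed above,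
  the unit vectors and then the vectors with correction terms would exclude every index from
  \<open>B\<close>.\<close>

lemma exists_coef_sum:
  assumes B: "B \<subseteq> {..<4 * g + 8}" "B \<noteq> {}"
  shows "\<exists>I\<subseteq>{..<4 * g + 8}. card I = 2 * g + 4 \<and> (\<Sum>j\<in>B. coef g I j) = 1"
proof (rule ccontr)
  assume no: "\<not> ?thesis"
  have fin: "finite B" using B(1) finite_subset by blast
  have sub: "insert m (matching g a c) \<subseteq> {..<4 * g + 8}"
    if "m < 4 * g + 8" "a < 2 * g + 3" "c < 2 * g + 5" for m a c
    using matching_properties(1)[OF that(2,3)] that(1) by simp
  have zero: "(\<Sum>j\<in>B. f j) = 0"
    if "insert m (matching g a c) \<subseteq> {..<4 * g + 8}" "card (insert m (matching g a c)) = 2 * g + 4"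
      "\<And>j. j < 4 * g + 8 \<Longrightarrow> coef g (insert m (matching g a c)) j = f j" for m a c f
  proof -
    have "(\<Sum>j\<in>B. coef g (insert m (matching g a c)) j) = (\<Sum>j\<in>B. f j)"
      using that(3) B(1) by (intro sum.cong) auto
    then show ?thesis using no that(1,2) by (metis bit_not_one_iff)
  qed
  have single: "(\<Sum>j\<in>B. of_bool (j = v)) = (of_bool (v \<in> B) :: bit)" for v
    using fin by (simp add: of_bool_def sum.delta)
  have pair: "(\<Sum>j\<in>B. of_bool (P \<and> j = v)) = (of_bool (P \<and> v \<in> B) :: bit)" for P v
    using single[of v] by (cases P) auto
  have 1: "2 * g + 1 \<notin> B"
    using zero[OF sub coef_A_odd_end] unfolding single by auto
  have 2: "2 * g + 2 \<notin> B"
    using zero[OF sub coef_A_even_end] unfolding single by auto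
  have odd: "b \<notin> B" if "even c" "2 \<le> c" "c < 2 * g + 5" "b = 2 * g + 3 + c" for b c
    using zero[OF sub coef_B_odd[OF that]] that(3) unfolding single by auto
  have even: "b \<notin> B" if "c = 0 \<or> odd c \<and> 5 \<le> c" "c < 2 * g + 5" "b = 2 * g + 3 + c" for b c
    using zero[OF sub coef_B_even[OF that]] that(2) unfolding single by auto
  have A: "of_bool (a \<in> B) + of_bool (a = 2 * g + 1 \<and> 2 * g + 4 \<in> B) +
      of_bool (a = 2 * g + 2 \<and> 2 * g + 6 \<in> B) = (0 :: bit)" if a: "a < 2 * g + 3" for a
    using zero[OF sub coef_A[OF a]] a unfolding sum.distrib single pair by simp
  \<comment> \<open>These two indices have no unit vector of their own; they appear as corrections
    in \<open>coef_A\<close> at \<open>2 * g + 1\<close> and \<open>2 * g + 2\<close>.\<close>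
  have "2 * g + 4 \<notin> B" "2 * g + 6 \<notin> B"
    using A[of "2 * g + 1"] A[of "2 * g + 2"] 1 2 by auto
  moreover have "a \<notin> B" if "a < 2 * g + 3" for a
    using A[OF that] 1 2 by (cases "a = 2 * g + 1 \<or> a = 2 * g + 2") auto
  moreover have "b \<notin> B" if b: "b \<ge> 2 * g + 3" "b < 4 * g + 8" "b \<noteq> 2 * g + 4" "b \<noteq> 2 * g + 6" for b
  proof -
    define c where "c = b - (2 * g + 3)"
    have c: "b = 2 * g + 3 + c" "c < 2 * g + 5" "c \<noteq> 1" "c \<noteq> 3" using b by (auto simp: c_def)
    then have "even c \<and> 2 \<le> c \<or> c = 0 \<or> odd c \<and> 5 \<le> c" by presburger
    then show ?thesis using odd[OF _ _ c(2,1)] even[OF _ c(2,1)] by blast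
  qed
  ultimately have "v \<notin> B" if "v < 4 * g + 8" for v
    using that by (metis not_le)
  with B show False by blast
qed

theorem theorem6:
  fixes k :: nat and b :: "nat \<Rightarrow> bool"
  assumes "even k" and "k \<ge> 4"
    and "b \<in> vecs (2*k)" and "b \<noteq> (\<lambda>_. False)"
  shows "alg_degree (2*k) (\<lambda>x. dotp (2*k) b (inv_into (vecs (2*k)) (chichi k) x)) = k"
proof -
  obtain g where k: "k = 2 * g + 4"
  proof -
    have "\<exists>g. k = 2 * g + 4" using assms(1,2) by presburger
    then show ?thesis using that by blast
  qed
  then have n: "2 * k = 4 * g + 8" by simp
  define N where "N = {..<4 * g + 8}"
  define f where "f = (\<lambda>x. dotp (2*k) b (inv_into (vecs (2*k)) (chichi k) x))"
  define B where "B = {j. j < 4 * g + 8 \<and> b j}"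
  have coeff: "of_bool (anf_coeff f S) = (\<Sum>j\<in>B. coef g (N - S) j)" if "S \<subseteq> N" for S
    using anf_coeff_inverse[OF chichi_bij, of S g b] that
    unfolding f_def n k B_def N_def coef_def by simp
  have upper: "card S \<le> k" if S: "S \<subseteq> N" "anf_coeff f S" for S
  proof (rule ccontr)
    assume "\<not> card S \<le> k"
    moreover have "card (N - S) + card S = 4 * g + 8"
      using S(1) card_Diff_subset[of S N] card_mono[of N S] finite_subset[of S N]
      unfolding N_def by simp
    ultimately have "card (N - S) < 2 * g + 4" using k by simp
    then have "(\<Sum>j\<in>B. coef g (N - S) j) = 0"
      unfolding N_def by (intro sum.neutral ballI coef_eq_0) auto
    with coeff[OF S(1)] S(2) show False by simp
  qed
  have "B \<noteq> {}"
  proof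
    assume "B = {}"
    then have "\<not> b i" for i
      using assms(3) by (cases "i < 4 * g + 8") (auto simp: B_def n vecs_def)
    then have "b = (\<lambda>_. False)" by auto
    with assms(4) show False by blast
  qed
  then obtain I where I: "I \<subseteq> N" "card I = k" "(\<Sum>j\<in>B. coef g I j) = 1"
    using exists_coef_sum[of B g] k unfolding N_def B_def by blast
  \<comment> \<open>\<open>I\<close> holds the rows restricted to zero, so the monomial is its
    complement; both have size \<open>k\<close> because \<open>N\<close> has \<open>2 * k\<close>
    elements.\<close>
  have "N - (N - I) = I" "card (N - I) = k"
    using I k card_Diff_subset[of I N] finite_subset[of I N] unfolding N_def by auto
  with coeff[of "N - I"] I(3) have "\<exists>S. card S = k \<and> S \<subseteq> N \<and> anf_coeff f S"
    by (intro exI[of _ "N - I"]) auto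
  then have mem: "k \<in> {card S | S. S \<subseteq> N \<and> anf_coeff f S}" by blast
  have le: "{card S | S. S \<subseteq> N \<and> anf_coeff f S} \<subseteq> {..k}" using upper by auto
  have "Max (insert 0 {card S | S. S \<subseteq> N \<and> anf_coeff f S}) = k"
    using mem le finite_subset[OF le] by (intro Max_eqI) auto
  then show ?thesis
    unfolding alg_degree_def f_def n N_def .
qed

end
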